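(* Let $r \ge 3$. There exists $t_0=t_0(r)$ such that for every integer $t\ge t_0$ the following holds. Suppose that $G \subseteq \mathbb{N}^{(r)}$ is an $r$-graph with $\binom{t-1}{r} \le |G| \le \binom{t}{r}$ that maximises the Lagrangian among $r$-graphs with $|G|$ edges, and suppose that $w$ is a maximal weighting of $G$ which is decreasing and satisfies $w(x) > 0$ for every non-isolated vertex $x$ of $G$. Then $G \subseteq [t]^{(r)}$.
   Context: $\mathbb{N}^{(r)}$ is the set of $r$-subsets of $\mathbb{N}=\{1,2,\dots\}$ and $[t]^{(r)}$ the set of $r$-subsets of $[t]=\{1,\dots,t\}$. An $r$-graph is a finite subset of $\mathbb{N}^{(r)}$; a non-isolated vertex is an element lying in some edge. A weighting of $\mathbb{N}$ is $w:\mathbb{N}\to[0,\infty)$ with $\sum_x w(x)=1$; $w(G)=\sum_{e\in G}\prod_{x\in e}w(x)$; the Lagrangian is $\lambda(G)=\max_w w(G)$, and $w$ is a maximal weighting of $G$ if $w(G)=\lambda(G)$. A weighting is decreasing if $w(i)\ge w(j)$ whenever $i<j$. *)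

theory Defs
  imports "HOL-Analysis.Analysis"
begin

definition rgraph :: "nat \<Rightarrow> nat set set \<Rightarrow> bool" where
  "rgraph r G \<longleftrightarrow> finite G \<and> (\<forall>e\<in>G. e \<subseteq> {1..} \<and> card e = r)"

text \<open>A weighting of the positive naturals: nonnegative, total weight 1.
  (The value at 0 is irrelevant.)\<close>
definition weighting :: "(nat \<Rightarrow> real) \<Rightarrow> bool" where
  "weighting w \<longleftrightarrow> (\<forall>x\<ge>1. 0 \<le> w x) \<and> (w has_sum 1) {1..}"

definition wval :: "(nat \<Rightarrow> real) \<Rightarrow> nat set set \<Rightarrow> real" where
  "wval w G = (\<Sum>e\<in>G. \<Prod>x\<in>e. w x)"

definition lagrangian :: "nat set set \<Rightarrow> real" where
  "lagrangian G = (SUP w\<in>{w. weighting w}. wval w G)"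

definition maximal_weighting :: "nat set set \<Rightarrow> (nat \<Rightarrow> real) \<Rightarrow> bool" where
  "maximal_weighting G w \<longleftrightarrow> weighting w \<and> wval w G = lagrangian G"

definition decreasing_weighting :: "(nat \<Rightarrow> real) \<Rightarrow> bool" where
  "decreasing_weighting w \<longleftrightarrow> (\<forall>i j. 1 \<le> i \<longrightarrow> i < j \<longrightarrow> w j \<le> w i)"

end

theory Submission
  imports Defs
begin

text \<open>
  Write \<open>T = t - 1\<close> and let \<open>V\<close> be the set of non-isolated vertices, on which \<open>w\<close> is supported.
  All partial derivatives of \<open>w(G)\<close> at vertices of \<open>V\<close> equal \<open>r \<lambda>(G)\<close>, and
  \<open>r! \<lambda>(G) \<ge> 1 - O(1/T)\<close> by comparison with a graph containing \<open>[T]\<^sup>(\<^sup>r\<^sup>)\<close>. As the derivative at \<open>v\<close> is at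
  most \<open>(1 - w v)^(r-1) / (r-1)!\<close>, all weights are \<open>O(1/T)\<close>; hence every degree is of order
  \<open>T^(r-1)\<close> and \<open>|V| = O(T)\<close>.

  Suppose \<open>|V| > t\<close>. Let \<open>z\<close> and \<open>u\<close> be the lightest and second lightest vertices. Moving the weight of
  \<open>z\<close> onto \<open>u\<close> loses only \<open>O((w z)\<^sup>2)\<close>, and then the \<open>deg z\<close> edges at \<open>z\<close> can be replaced by
  non-edges inside \<open>V - {z}\<close>, of which there are at least \<open>deg z\<close>. If \<open>w u\<close> is of order \<open>1/T\<close>, any
  such non-edges gain order \<open>1/T\<close>, which beats the loss. If \<open>w u\<close> is much smaller, compare the
  derivatives at \<open>u\<close> and at a heaviest vertex: they can agree only if non-edges at \<open>u\<close> of total weight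
  of order \<open>w u / T\<close> avoid \<open>z\<close>, and the heaviest \<open>deg z\<close> of them retain a constant proportion.
  Either way \<open>G\<close> was not a maximiser.
\<close>

section \<open>Elementary symmetric polynomials of the weights\<close>

text \<open>This is also the value of the complete \<open>k\<close>-graph on \<open>X\<close>, so it
  serves as upper bound for all degree and codegree sums.\<close>

definition esym :: "('a \<Rightarrow> real) \<Rightarrow> nat \<Rightarrow> 'a set \<Rightarrow> real" where
  "esym w k X = (\<Sum>f | f \<subseteq> X \<and> card f = k. \<Prod>x\<in>f. w x)"

lemma finite_subsets_card: "finite X \<Longrightarrow> finite {f. f \<subseteq> X \<and> card f = k}"
  by (rule finite_subset[of _ "Pow X"]) auto

lemma esym_nonneg:
  assumes "\<And>x. x \<in> X \<Longrightarrow> 0 \<le> w x"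
  shows "0 \<le> esym w k X"
  unfolding esym_def by (intro sum_nonneg prod_nonneg) (use assms in auto)

lemma esym_0: "finite X \<Longrightarrow> esym w 0 X = 1"
proof -
  assume X: "finite X"
  have "{f. f \<subseteq> X \<and> card f = 0} = {{}}"
    using X finite_subset by fastforce
  thus ?thesis by (simp add: esym_def)
qed

lemma esym_Suc_empty: "esym w (Suc k) {} = 0"
proof -
  have "{f. f \<subseteq> {} \<and> card f = Suc k} = {}" by auto
  thus ?thesis unfolding esym_def by (metis sum.empty)
qed

lemma esym_insert:
  assumes "finite X" "v \<notin> X"
  shows "esym w (Suc k) (insert v X) = esym w (Suc k) X + w v * esym w k X"
proof -
  let ?A = "{f. f \<subseteq> X \<and> card f = Suc k}" and ?B = "{f. f \<subseteq> X \<and> card f = k}"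
  have eq: "{f. f \<subseteq> insert v X \<and> card f = Suc k} = ?A \<union> insert v ` ?B"
  proof (intro set_eqI iffI)
    fix f assume f: "f \<in> {f. f \<subseteq> insert v X \<and> card f = Suc k}"
    hence fin: "finite f" using assms finite_subset by blast
    show "f \<in> ?A \<union> insert v ` ?B"
    proof (cases "v \<in> f")
      case True
      hence "f - {v} \<in> ?B" "f = insert v (f - {v})" using f fin by auto
      thus ?thesis by blast
    qed (use f in auto)
  next
    fix f assume "f \<in> ?A \<union> insert v ` ?B"
    thus "f \<in> {f. f \<subseteq> insert v X \<and> card f = Suc k}"
      using assms finite_subset[of _ X] by (auto simp: card_insert_if)
  qed
  have inj: "inj_on (insert v) ?B"
    using assms by (auto simp: inj_on_def)
  have "esym w (Suc k) (insert v X) = esym w (Suc k) X + (\<Sum>f\<in>insert v ` ?B. \<Prod>x\<in>f. w x)"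
    unfolding esym_def eq
    by (rule sum.union_disjoint) (use assms finite_subsets_card in auto)
  also have "(\<Sum>f\<in>insert v ` ?B. \<Prod>x\<in>f. w x) = (\<Sum>f\<in>?B. \<Prod>x\<in>insert v f. w x)"
    using inj by (simp add: sum.reindex)
  also have "\<dots> = (\<Sum>f\<in>?B. w v * (\<Prod>x\<in>f. w x))"
    by (rule sum.cong) (use assms finite_subset in \<open>auto intro!: prod.insert\<close>)
  finally show ?thesis by (simp add: esym_def sum_distrib_left)
qed

lemma esym_remove:
  assumes "finite X" "v \<in> X"
  shows "esym w (Suc k) X = esym w (Suc k) (X - {v}) + w v * esym w k (X - {v})"
  using esym_insert[of "X - {v}" v w k] assms by (simp add: insert_absorb)

text \<open>Expanding \<open>sum w X * esym w k X\<close> yields each product over a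
  \<open>Suc k\<close>-set once per element, plus nonnegative terms with a repeated vertex. In the
  induction that surplus is \<open>w v * (w v * esym w j X)\<close>.\<close>

lemma esym_Suc_le:
  assumes "finite X" "\<And>x. x \<in> X \<Longrightarrow> 0 \<le> w x"
  shows "real (Suc k) * esym w (Suc k) X \<le> sum w X * esym w k X"
  using assms
proof (induction X arbitrary: k rule: finite_induct)
  case empty
  show ?case by (simp add: esym_Suc_empty)
next
  case (insert v X)
  have wv: "0 \<le> w v" and sX: "0 \<le> sum w X" using insert by (auto intro: sum_nonneg)
  have IH: "real (Suc j) * esym w (Suc j) X \<le> sum w X * esym w j X" for j
    using insert by auto
  show ?case
  proof (cases k)
    case 0
    thus ?thesis using IH[of 0] insert by (simp add: esym_insert esym_0)
  next
    case (Suc j)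
    have nn: "0 \<le> esym w j X" using insert by (intro esym_nonneg) auto
    have "w v * (real (Suc j) * esym w (Suc j) X) \<le> w v * (sum w X * esym w j X)"
      using IH[of j] wv by (rule mult_left_mono)
    moreover have "0 \<le> w v * (w v * esym w j X)" using wv nn by simp
    ultimately show ?thesis using IH[of k] insert(1,2) Suc
      by (simp add: esym_insert algebra_simps)
  qed
qed

text \<open>Iterates \<open>esym_Suc_le\<close>. Applied to \<open>V - {v}\<close>, it bounds a
  derivative by a power of \<open>1 - w v\<close>.\<close>

lemma esym_le_power:
  assumes "finite X" "\<And>x. x \<in> X \<Longrightarrow> 0 \<le> w x"
  shows "fact k * esym w k X \<le> sum w X ^ k"
proof (induction k)
  case 0
  thus ?case using assms by (simp add: esym_0)
next
  case (Suc k)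
  have sX: "0 \<le> sum w X" using assms by (auto intro: sum_nonneg)
  have "fact (Suc k) * esym w (Suc k) X = fact k * (real (Suc k) * esym w (Suc k) X)"
    by (simp add: algebra_simps)
  also have "\<dots> \<le> fact k * (sum w X * esym w k X)"
    using esym_Suc_le[OF assms] by (intro mult_left_mono) auto
  also have "\<dots> = sum w X * (fact k * esym w k X)" by simp
  also have "\<dots> \<le> sum w X * sum w X ^ k" using Suc sX by (rule mult_left_mono)
  finally show ?case by simp
qed

lemma esym_le_1:
  assumes "finite X" "\<And>x. x \<in> X \<Longrightarrow> 0 \<le> w x" "sum w X \<le> 1"
  shows "esym w k X \<le> 1"
proof -
  have "1 * esym w k X \<le> fact k * esym w k X"
    using assms by (intro mult_right_mono esym_nonneg) (auto simp: fact_ge_1)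
  also have "\<dots> \<le> sum w X ^ k" using assms by (intro esym_le_power) auto
  also have "\<dots> \<le> 1" using assms by (intro power_le_one sum_nonneg) auto
  finally show ?thesis by simp
qed

lemma esym_Suc_le_esym:
  assumes "finite X" "\<And>x. x \<in> X \<Longrightarrow> 0 \<le> w x" "sum w X \<le> 1"
  shows "esym w (Suc k) X \<le> esym w k X"
proof -
  have nn: "0 \<le> esym w (Suc k) X" "0 \<le> esym w k X" using assms by (auto intro: esym_nonneg)
  have "esym w (Suc k) X \<le> real (Suc k) * esym w (Suc k) X"
    using nn by (simp add: mult_le_cancel_right1)
  also have "\<dots> \<le> sum w X * esym w k X" using assms by (intro esym_Suc_le) auto
  also have "\<dots> \<le> 1 * esym w k X" using assms nn by (intro mult_right_mono) auto
  finally show ?thesis by simp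
qed

section \<open>Derivatives and moving weight between two vertices\<close>

text \<open>The partial derivative of \<open>wval w G\<close> at \<open>v\<close>, since
  \<open>wval\<close> is linear in each single weight.\<close>

definition wdeg :: "(nat \<Rightarrow> real) \<Rightarrow> nat set set \<Rightarrow> nat \<Rightarrow> real" where
  "wdeg w G v = (\<Sum>e | e \<in> G \<and> v \<in> e. \<Prod>x\<in>e - {v}. w x)"

text \<open>For distinct \<open>u\<close> and \<open>v\<close>, the mixed second partial
  derivative.\<close>

definition wcodeg :: "(nat \<Rightarrow> real) \<Rightarrow> nat set set \<Rightarrow> nat \<Rightarrow> nat \<Rightarrow> real" where
  "wcodeg w G u v = (\<Sum>e | e \<in> G \<and> u \<in> e \<and> v \<in> e. \<Prod>x\<in>e - {u, v}. w x)"

text \<open>A square-free monomial is linear in \<open>w u\<close> and in \<open>w v\<close>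
  separately, so its second-order Taylor expansion is exact.\<close>

lemma prod_transfer:
  fixes w :: "nat \<Rightarrow> real"
  assumes "finite e" "u \<noteq> v"
  shows "(\<Prod>x\<in>e. (w(v := w v + s, u := w u - s)) x) = (\<Prod>x\<in>e. w x)
    + s * ((if v \<in> e then \<Prod>x\<in>e - {v}. w x else 0) - (if u \<in> e then \<Prod>x\<in>e - {u}. w x else 0))
    - s\<^sup>2 * (if u \<in> e \<and> v \<in> e then \<Prod>x\<in>e - {u, v}. w x else 0)"
proof -
  let ?w = "w(v := w v + s, u := w u - s)"
  have same: "(\<Prod>x\<in>f. ?w x) = (\<Prod>x\<in>f. w x)" if "u \<notin> f" "v \<notin> f" for f
    using that by (intro prod.cong) auto
  have rm: "(\<Prod>x\<in>f. g x) = g a * (\<Prod>x\<in>f - {a}. g x)" if "a \<in> f" "finite f" for a f and g :: "nat \<Rightarrow> real"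
    using that by (simp add: prod.remove)
  have uv: "e - {u} - {v} = e - {u, v}" "e - {v} - {u} = e - {u, v}" by auto
  consider "u \<in> e" "v \<in> e" | "u \<in> e" "v \<notin> e" | "u \<notin> e" "v \<in> e" | "u \<notin> e" "v \<notin> e" by blast
  thus ?thesis
  proof cases
    case 1
    define P where "P = (\<Prod>x\<in>e - {u, v}. w x)"
    have "(\<Prod>x\<in>e - {u}. w x) = w v * P" "(\<Prod>x\<in>e - {v}. w x) = w u * P"
      using 1 assms rm[of v "e - {u}" w] rm[of u "e - {v}" w] by (auto simp: uv P_def)
    moreover have "(\<Prod>x\<in>e. w x) = w u * (w v * P)"
      using rm[of u e w] 1 assms calculation by simp
    moreover have "(\<Prod>x\<in>e. ?w x) = ?w u * (?w v * P)"
      using rm[of u e ?w] rm[of v "e - {u}" ?w] 1 assms same[of "e - {u, v}"] by (simp add: uv P_def)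
    ultimately show ?thesis using 1 assms
      by (simp add: P_def[symmetric] algebra_simps power2_eq_square)
  next
    case 2
    have "(\<Prod>x\<in>e. ?w x) = ?w u * (\<Prod>x\<in>e - {u}. w x)"
      using rm[of u e ?w] 2 assms same[of "e - {u}"] by simp
    thus ?thesis using 2 rm[of u e w] assms by (simp add: algebra_simps)
  next
    case 3
    have "(\<Prod>x\<in>e. ?w x) = ?w v * (\<Prod>x\<in>e - {v}. w x)"
      using rm[of v e ?w] 3 assms same[of "e - {v}"] by simp
    thus ?thesis using 3 rm[of v e w] assms by (simp add: algebra_simps)
  next
    case 4
    thus ?thesis using same[of e] by simp
  qed
qed

lemma wval_transfer:
  assumes "finite G" "\<And>e. e \<in> G \<Longrightarrow> finite e" "u \<noteq> v"
  shows "wval (w(v := w v + s, u := w u - s)) G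
    = wval w G + s * (wdeg w G v - wdeg w G u) - s\<^sup>2 * wcodeg w G u v"
proof -
  have "wdeg w G y = (\<Sum>e\<in>G. if y \<in> e then \<Prod>x\<in>e - {y}. w x else 0)" for y
    unfolding wdeg_def using assms(1) by (intro sum.mono_neutral_cong_left) auto
  moreover have "wcodeg w G u v = (\<Sum>e\<in>G. if u \<in> e \<and> v \<in> e then \<Prod>x\<in>e - {u, v}. w x else 0)"
    unfolding wcodeg_def using assms(1) by (intro sum.mono_neutral_cong_left) auto
  moreover have "wval (w(v := w v + s, u := w u - s)) G = (\<Sum>e\<in>G. (\<Prod>x\<in>e. w x)
    + s * ((if v \<in> e then \<Prod>x\<in>e - {v}. w x else 0) - (if u \<in> e then \<Prod>x\<in>e - {u}. w x else 0))
    - s\<^sup>2 * (if u \<in> e \<and> v \<in> e then \<Prod>x\<in>e - {u, v}. w x else 0))"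
    unfolding wval_def using assms by (intro sum.cong refl prod_transfer) auto
  ultimately show ?thesis
    by (simp only: wval_def sum.distrib sum_subtractf sum_distrib_left right_diff_distrib)
qed

section \<open>Double counting, averaging and a binomial estimate\<close>

text \<open>Each edge is counted once for each of its \<open>r\<close> vertices. Constant
  \<open>g\<close> gives the handshake identity, edge products give Euler's identity.\<close>

lemma sum_over_incidences:
  fixes g :: "'a set \<Rightarrow> real"
  assumes "finite G" "finite V" "\<And>e. e \<in> G \<Longrightarrow> e \<subseteq> V \<and> card e = r"
  shows "(\<Sum>v\<in>V. \<Sum>e | e \<in> G \<and> v \<in> e. g e) = real r * sum g G"
proof -
  have "(\<Sum>v\<in>V. \<Sum>e | e \<in> G \<and> v \<in> e. g e) = (\<Sum>e\<in>G. \<Sum>v | v \<in> V \<and> v \<in> e. g e)"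
    using sum.swap_restrict[OF assms(2,1), of "\<lambda>v e. g e" "\<lambda>v e. v \<in> e"] by simp
  also have "\<dots> = (\<Sum>e\<in>G. real r * g e)"
  proof (rule sum.cong[OF refl])
    fix e assume "e \<in> G"
    hence "{v. v \<in> V \<and> v \<in> e} = e" "card e = r" using assms(3) by auto
    thus "(\<Sum>v | v \<in> V \<and> v \<in> e. g e) = real r * g e" by simp
  qed
  finally show ?thesis by (simp add: sum_distrib_left)
qed

text \<open>Euler's identity for the homogeneous polynomial \<open>wval\<close> of degree
  \<open>r\<close>.\<close>

lemma sum_weight_wdeg:
  assumes "finite G" "finite V" "\<And>e. e \<in> G \<Longrightarrow> e \<subseteq> V \<and> card e = r"
  shows "(\<Sum>v\<in>V. w v * wdeg w G v) = real r * wval w G"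
proof -
  have "w v * wdeg w G v = (\<Sum>e | e \<in> G \<and> v \<in> e. \<Prod>x\<in>e. w x)" for v
    unfolding wdeg_def sum_distrib_left
  proof (rule sum.cong[OF refl])
    fix e assume "e \<in> {e. e \<in> G \<and> v \<in> e}"
    hence "finite e" "v \<in> e" using assms finite_subset by blast+
    thus "w v * (\<Prod>x\<in>e - {v}. w x) = (\<Prod>x\<in>e. w x)" by (simp add: prod.remove)
  qed
  thus ?thesis using sum_over_incidences[OF assms, of "\<lambda>e. \<Prod>x\<in>e. w x"]
    by (simp add: wval_def)
qed

text \<open>Discarding a least element never lowers the average; repeat until \<open>k\<close>
  elements remain.\<close>

lemma exists_heavy_subset:
  fixes g :: "'a \<Rightarrow> real"
  assumes "finite N" "k \<le> card N" "\<And>x. x \<in> N \<Longrightarrow> 0 \<le> g x"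
  obtains B where "B \<subseteq> N" "card B = k" "real k * sum g N \<le> real (card N) * sum g B"
proof -
  have "\<exists>B\<subseteq>N. card B = k \<and> real k * sum g N \<le> real (card N) * sum g B"
    using assms
  proof (induction "card N - k" arbitrary: N)
    case 0
    thus ?case by (intro exI[of _ N]) auto
  next
    case (Suc d)
    hence "N \<noteq> {}" by auto
    define m where "m = Min (g ` N)"
    have "m \<in> g ` N" unfolding m_def using Suc \<open>N \<noteq> {}\<close> by (intro Min_in) auto
    then obtain y where y: "y \<in> N" "g y = m" by auto
    have m: "m \<le> g x" if "x \<in> N" for x unfolding m_def using that Suc by simp
    have c: "card N = Suc (card (N - {y}))" using y Suc.prems card_Suc_Diff1[of N y] by simp
    have s: "sum g N = m + sum g (N - {y})" using y Suc.prems sum.remove[of N y g] by simp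
    have d: "d = card (N - {y}) - k" "k \<le> card (N - {y})"
      using Suc.hyps(2) c by linarith+
    obtain B where B: "B \<subseteq> N - {y}" "card B = k"
      "real k * sum g (N - {y}) \<le> real (card (N - {y})) * sum g B"
      using Suc.hyps(1)[of "N - {y}"] d Suc.prems by auto
    have "real k * m = (\<Sum>x\<in>B. m)" using B by simp
    also have "\<dots> \<le> sum g B" using B m by (intro sum_mono) auto
    finally have "real k * sum g N \<le> real (card N) * sum g B"
      using B(3) c s by (simp add: algebra_simps)
    thus ?case using B by (intro exI[of _ B]) auto
  qed
  thus ?thesis using that by blast
qed

text \<open>\<open>N'\<close> carries the weight but may have fewer than \<open>k\<close> elements;
  it is then padded from \<open>N\<close>. The common bound \<open>M\<close> lets one inequality
  cover both cases.\<close>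

lemma exists_heavy_superset:
  fixes g :: "'a \<Rightarrow> real"
  assumes "finite N" "N' \<subseteq> N" "k \<le> card N" "\<And>x. x \<in> N \<Longrightarrow> 0 \<le> g x"
    and "card N' \<le> M" "k \<le> M"
  obtains B where "B \<subseteq> N" "card B = k" "real k * sum g N' \<le> real M * sum g B"
proof (cases "k \<le> card N'")
  case True
  have fin: "finite N'" using assms finite_subset by blast
  obtain B where B: "B \<subseteq> N'" "card B = k" "real k * sum g N' \<le> real (card N') * sum g B"
    by (rule exists_heavy_subset[OF fin True, of g]) (use assms in auto)
  have "real (card N') * sum g B \<le> real M * sum g B"
    using assms B by (intro mult_right_mono sum_nonneg) auto
  thus ?thesis using B assms that[of B] by auto
next
  case False
  then obtain B where B: "N' \<subseteq> B" "B \<subseteq> N" "card B = k"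
    using exists_subset_between[of N' k N] assms by auto
  have "sum g N' \<le> sum g B"
    using B assms finite_subset by (intro sum_mono2) auto
  moreover have "0 \<le> sum g N'" using assms by (intro sum_nonneg) auto
  ultimately have "real k * sum g N' \<le> real M * sum g B"
    using assms by (intro mult_mono) auto
  thus ?thesis using B that by blast
qed

text \<open>The right side is the product of \<open>1 - i/T\<close> over \<open>i < r\<close>. Each
  factor costs at most \<open>i/T\<close>, and these costs add up to less than
  \<open>r^2/T\<close>.\<close>

lemma falling_factorial_lower:
  assumes "r \<le> T" "0 < T"
  shows "1 - (real r)\<^sup>2 / real T \<le> fact r * real (T choose r) / real T ^ r"
proof -
  define p where "p k = (\<Prod>i<k. 1 - real i / real T)" for k
  have "0 \<le> p k \<and> p k \<le> 1 \<and> 1 - (real k)\<^sup>2 / real T \<le> p k" if "k \<le> T" for k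
    using that
  proof (induction k)
    case 0
    show ?case by (simp add: p_def)
  next
    case (Suc k)
    hence IH: "0 \<le> p k" "p k \<le> 1" "1 - (real k)\<^sup>2 / real T \<le> p k" by auto
    have q: "0 \<le> real k / real T" "real k / real T \<le> 1" using Suc.prems by auto
    have P: "p (Suc k) = p k - p k * (real k / real T)" by (simp add: p_def algebra_simps)
    have le: "p k * (real k / real T) \<le> 1 * (real k / real T)" using IH q by (intro mult_right_mono) auto
    have ge: "0 \<le> p k * (real k / real T)" using IH q by simp
    have "p k * (real k / real T) \<le> p k * 1" using IH q by (intro mult_left_mono) auto
    moreover have "(real (Suc k))\<^sup>2 / real T = (real k)\<^sup>2 / real T + 2 * (real k / real T) + 1 / real T"
      by (simp add: power2_eq_square add_divide_distrib algebra_simps)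
    moreover have "0 \<le> 1 / real T" by simp
    ultimately show ?case using P le ge IH q by linarith
  qed
  hence "1 - (real r)\<^sup>2 / real T \<le> p r" using assms by auto
  also have "p r = (\<Prod>i<r. (real T - real i) / real T)"
    unfolding p_def using assms by (intro prod.cong) (auto simp: field_simps)
  also have "\<dots> = fact r * (real T gchoose r) / real T ^ r"
    by (simp add: prod_dividef gbinomial_mult_fact atLeast0LessThan)
  finally show ?thesis by (simp add: binomial_gbinomial)
qed

section \<open>Weightings and the Lagrangian\<close>

lemma weighting_finiteI:
  assumes "finite X" "X \<subseteq> {1..}" "\<And>x. x \<in> X \<Longrightarrow> 0 \<le> w x"
    "\<And>x. 1 \<le> x \<Longrightarrow> x \<notin> X \<Longrightarrow> w x = 0" "sum w X = 1"
  shows "weighting w"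
  unfolding weighting_def
proof
  show "\<forall>x\<ge>1. 0 \<le> w x" using assms(3,4) by (metis order_refl)
  show "(w has_sum 1) {1..}"
    by (rule has_sum_finite_neutralI[of X]) (use assms in auto)
qed

lemma weighting_le_1:
  assumes "weighting w" "1 \<le> x"
  shows "w x \<le> 1"
  using finite_sum_le_has_sum[of w "{1..}" 1 "{x}"] assms by (auto simp: weighting_def)

lemma wval_le_lagrangian:
  assumes "rgraph r G" "weighting w"
  shows "wval w G \<le> lagrangian G"
  unfolding lagrangian_def
proof (rule cSUP_upper)
  \<comment> \<open>The supremum is meaningful only if bounded: each edge contributes at most 1, so
    \<open>card G\<close> is a bound.\<close>
  show "bdd_above ((\<lambda>w. wval w G) ` {w. weighting w})"
  proof (rule bdd_aboveI2)
    fix w assume w: "w \<in> {w. weighting w}"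
    have "(\<Prod>x\<in>e. w x) \<le> 1" if "e \<in> G" for e
    proof (rule prod_le_1)
      fix x assume "x \<in> e"
      hence "1 \<le> x" using that assms by (auto simp: rgraph_def)
      thus "0 \<le> w x \<and> w x \<le> 1" using w weighting_le_1 by (auto simp: weighting_def)
    qed
    hence "wval w G \<le> (\<Sum>e\<in>G. 1)" unfolding wval_def by (intro sum_mono) auto
    thus "wval w G \<le> real (card G)" by simp
  qed
qed (use assms in auto)

text \<open>Witnessed by the uniform weighting on \<open>{1..T}\<close>.\<close>

lemma lagrangian_ge_of_complete_subgraph:
  assumes "rgraph r H" "{e. e \<subseteq> {1..T} \<and> card e = r} \<subseteq> H" "0 < T"
  shows "real (T choose r) / real T ^ r \<le> lagrangian H"
proof -
  define w :: "nat \<Rightarrow> real" where "w x = (if x \<in> {1..T} then 1 / real T else 0)" for x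
  let ?K = "{e. e \<subseteq> {1..T} \<and> card e = r}"
  have w: "weighting w"
    by (rule weighting_finiteI[of "{1..T}"]) (use assms in \<open>auto simp: w_def\<close>)
  have "(\<Prod>x\<in>e. w x) = 1 / real T ^ r" if "e \<in> ?K" for e
  proof -
    have "(\<Prod>x\<in>e. w x) = (\<Prod>x\<in>e. 1 / real T)" using that by (intro prod.cong) (auto simp: w_def)
    thus ?thesis using that by (simp add: power_divide)
  qed
  hence "real (T choose r) / real T ^ r = wval w ?K"
    using n_subsets[of "{1..T}" r] by (simp add: wval_def)
  also have "\<dots> \<le> wval w H"
    unfolding wval_def using assms
    by (intro sum_mono2 prod_nonneg) (auto simp: rgraph_def w_def)
  also have "\<dots> \<le> lagrangian H" using assms(1) w by (rule wval_le_lagrangian)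
  finally show ?thesis .
qed

section \<open>Degrees and codegrees against elementary symmetric polynomials\<close>

lemma sum_link_eq_esym:
  assumes "finite X" "u \<notin> X"
  shows "(\<Sum>e | e \<subseteq> insert u X \<and> card e = Suc k \<and> u \<in> e. \<Prod>x\<in>e - {u}. w x) = esym w k X"
  unfolding esym_def
proof (rule sum.reindex_bij_witness[of _ "insert u" "\<lambda>e. e - {u}"])
  fix e assume "e \<in> {e. e \<subseteq> insert u X \<and> card e = Suc k \<and> u \<in> e}"
  moreover from this have "finite e" using assms finite_subset by blast
  ultimately show "e - {u} \<in> {f. f \<subseteq> X \<and> card f = k}" "insert u (e - {u}) = e" by auto
next
  fix f assume "f \<in> {f. f \<subseteq> X \<and> card f = k}"
  moreover from this have "finite f" using assms finite_subset by blast
  ultimately show "insert u f \<in> {e. e \<subseteq> insert u X \<and> card e = Suc k \<and> u \<in> e}"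
    "insert u f - {u} = f" using assms by (auto simp: card_insert_if)
qed simp

lemma wdeg_le_esym:
  assumes "finite V" "\<And>x. x \<in> V \<Longrightarrow> 0 \<le> w x" "\<And>e. e \<in> G \<Longrightarrow> e \<subseteq> V \<and> card e = Suc k" "v \<in> V"
  shows "wdeg w G v \<le> esym w k (V - {v})"
proof -
  have "wdeg w G v
      \<le> (\<Sum>e | e \<subseteq> insert v (V - {v}) \<and> card e = Suc k \<and> v \<in> e. \<Prod>x\<in>e - {v}. w x)"
    unfolding wdeg_def
  proof (rule sum_mono2)
    show "finite {e. e \<subseteq> insert v (V - {v}) \<and> card e = Suc k \<and> v \<in> e}"
      by (rule finite_subset[of _ "Pow (insert v V)"]) (use assms in auto)
  qed (use assms in \<open>auto intro!: prod_nonneg\<close>)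
  also have "\<dots> = esym w k (V - {v})" by (rule sum_link_eq_esym) (use assms in auto)
  finally show ?thesis .
qed

lemma wcodeg_le_esym:
  assumes "finite V" "\<And>x. x \<in> V \<Longrightarrow> 0 \<le> w x"
    "\<And>e. e \<in> G \<Longrightarrow> e \<subseteq> V \<and> card e = Suc (Suc k)" "u \<noteq> v"
  shows "wcodeg w G u v \<le> esym w k V"
proof -
  let ?E = "{e. e \<in> G \<and> u \<in> e \<and> v \<in> e}"
  have inj: "inj_on (\<lambda>e. e - {u, v}) ?E"
  proof (rule inj_onI)
    fix e f assume "e \<in> ?E" "f \<in> ?E" and eq: "e - {u, v} = f - {u, v}"
    hence "e = (e - {u, v}) \<union> {u, v}" "f = (f - {u, v}) \<union> {u, v}" by auto
    thus "e = f" using eq by simp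
  qed
  have "wcodeg w G u v = (\<Sum>f\<in>(\<lambda>e. e - {u, v}) ` ?E. \<Prod>x\<in>f. w x)"
    unfolding wcodeg_def using inj by (simp add: sum.reindex)
  also have "\<dots> \<le> esym w k V"
    unfolding esym_def
  proof (rule sum_mono2)
    show "(\<lambda>e. e - {u, v}) ` ?E \<subseteq> {f. f \<subseteq> V \<and> card f = k}"
    proof clarify
      fix e assume e: "e \<in> G" "u \<in> e" "v \<in> e"
      hence "finite e" using assms finite_subset by blast
      thus "e - {u, v} \<subseteq> V \<and> card (e - {u, v}) = k"
        using e assms by (auto simp: card_Diff_subset)
    qed
  qed (use assms finite_subsets_card in \<open>auto intro!: prod_nonneg\<close>)
  finally show ?thesis .
qed

section \<open>Constants depending on \<open>r\<close> only\<close>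

text \<open>Lower bound for the common derivative \<open>real r * lagrangian G\<close>, coming from
  \<open>fact r * lagrangian G\<close> being at least 1/2.\<close>

definition deriv_const :: "nat \<Rightarrow> real" where
  "deriv_const r = 1 / (2 * fact (r - 1))"

text \<open>Degrees are at least this times \<open>T^(r-1)\<close>: a derivative is at least
  \<open>deriv_const r\<close>, and each edge adds at most \<open>(r^2/T)^(r-1)\<close> to
  it.\<close>

definition degree_const :: "nat \<Rightarrow> real" where
  "degree_const r = deriv_const r / ((real r)\<^sup>2) ^ (r - 1)"

text \<open>Bounds \<open>card V / T\<close>, by comparing the degree sum with
  \<open>r * card G\<close> and \<open>card G\<close> with \<open>(2*T)^r\<close>.\<close>

definition support_const :: "nat \<Rightarrow> real" where
  "support_const r = real r * 2 ^ r / degree_const r"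

text \<open>The second lightest vertex counts as light if its weight is below \<open>light_const r / T\<close>; the
  value is chosen so that the gain from non-edges at a light vertex exceeds the loss.\<close>

definition light_const :: "nat \<Rightarrow> real" where
  "light_const r = degree_const r / support_const r ^ (r - 1) * deriv_const r / (8 * support_const r)"

lemma consts_bounds:
  assumes "1 \<le> r"
  shows "0 < deriv_const r" "deriv_const r \<le> 1 / 2" "0 < degree_const r" "degree_const r \<le> 1"
    "1 \<le> support_const r" "0 < light_const r" "light_const r \<le> deriv_const r / (8 * support_const r)"
proof -
  show c: "0 < deriv_const r" by (simp add: deriv_const_def)
  have f: "(1::real) \<le> fact (r - 1)" by (simp add: fact_ge_1)
  show c2: "deriv_const r \<le> 1 / 2" unfolding deriv_const_def using f by (simp add: field_simps)
  have p: "1 \<le> ((real r)\<^sup>2) ^ (r - 1)" using assms by (intro one_le_power) auto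
  show a: "0 < degree_const r" unfolding degree_const_def using c p by simp
  have "degree_const r \<le> deriv_const r / 1"
    unfolding degree_const_def using c p by (intro divide_left_mono) auto
  thus a1: "degree_const r \<le> 1" using c2 by simp
  have "1 * 1 \<le> real r * 2 ^ r" using assms by (intro mult_mono) auto
  hence "degree_const r \<le> real r * 2 ^ r" using a1 by simp
  thus b: "1 \<le> support_const r" unfolding support_const_def using a by simp
  have q: "0 < degree_const r / support_const r ^ (r - 1)" using a b by simp
  have "degree_const r / support_const r ^ (r - 1) \<le> 1"
    using order_trans[OF a1 one_le_power[OF b, of "r - 1"]] b by (simp add: divide_le_eq)
  moreover have l: "light_const r
      = degree_const r / support_const r ^ (r - 1) * (deriv_const r / (8 * support_const r))"
    by (simp add: light_const_def)
  moreover have d: "0 < deriv_const r / (8 * support_const r)" using b c by simp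
  ultimately show "light_const r \<le> deriv_const r / (8 * support_const r)"
    using mult_right_mono[of "degree_const r / support_const r ^ (r - 1)" 1 "deriv_const r / (8 * support_const r)"]
    by simp
  show "0 < light_const r" unfolding l using q d by (rule mult_pos_pos)
qed

section \<open>A maximiser: lower bound for the Lagrangian and support of the weighting\<close>

text \<open>\<open>T\<close> stands for \<open>t - 1\<close>; \<open>T_ge\<close> makes
  \<open>r^2/T\<close> at most 1/2.\<close>

locale lagrangian_maximiser =
  fixes r T :: nat and G :: "nat set set" and w :: "nat \<Rightarrow> real"
  assumes r_ge: "2 \<le> r" and T_ge: "2 * r\<^sup>2 \<le> T"
    and rgraph_G: "rgraph r G"
    and card_ge: "T choose r \<le> card G" and card_le: "card G \<le> Suc T choose r"
    and maximal: "\<And>H. rgraph r H \<Longrightarrow> card H = card G \<Longrightarrow> lagrangian H \<le> lagrangian G"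
    and max_weighting: "maximal_weighting G w"
    and pos: "\<And>x. x \<in> \<Union>G \<Longrightarrow> 0 < w x"
begin

abbreviation "V \<equiv> \<Union>G"

lemma finite_G: "finite G" and edge: "e \<in> G \<Longrightarrow> e \<subseteq> V \<and> card e = r" and V_ge: "V \<subseteq> {1..}"
  using rgraph_G by (auto simp: rgraph_def)

text \<open>An infinite set has \<open>card\<close> 0, whereas edges have at least two
  elements.\<close>

lemma finite_edge: "e \<in> G \<Longrightarrow> finite e"
  using edge r_ge card.infinite by fastforce

lemma finite_V: "finite V"
  using finite_G finite_edge by blast

lemma T_bounds: "r \<le> T" "0 < T" "2 * (real r)\<^sup>2 \<le> real T"
proof -
  have "r * 1 \<le> r * r" using r_ge by (intro mult_left_mono) auto
  hence "r \<le> 2 * r\<^sup>2" by (simp add: power2_eq_square)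
  thus "r \<le> T" using T_ge by (rule order_trans)
  thus "0 < T" using r_ge by simp
  have "real (2 * r\<^sup>2) \<le> real T" using T_ge by (simp only: of_nat_le_iff)
  thus "2 * (real r)\<^sup>2 \<le> real T" by simp
qed

lemma weighting_w: "weighting w" and wval_eq: "wval w G = lagrangian G"
  using max_weighting by (auto simp: maximal_weighting_def)

text \<open>The bounds on \<open>card G\<close> leave room for a competitor \<open>H\<close> of the
  same size between the complete \<open>r\<close>-graphs on \<open>{1..T}\<close> and
  \<open>{1..Suc T}\<close>.\<close>

lemma lagrangian_ge: "1 - (real r)\<^sup>2 / real T \<le> fact r * lagrangian G"
proof -
  let ?K = "\<lambda>n. {e. e \<subseteq> {1..n} \<and> card e = r}"
  have K: "card (?K n) = n choose r" "finite (?K n)" for n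
    using n_subsets[of "{1..n}" r] finite_subsets_card[of "{1..n}" r] by auto
  have "?K T \<subseteq> ?K (Suc T)" by auto
  then obtain H where H: "?K T \<subseteq> H" "H \<subseteq> ?K (Suc T)" "card H = card G"
    using exists_subset_between[of "?K T" "card G" "?K (Suc T)"] K card_ge card_le by auto
  have "rgraph r H" using H(2) K(2)[of "Suc T"] finite_subset unfolding rgraph_def by fastforce
  hence "real (T choose r) / real T ^ r \<le> lagrangian G"
    using lagrangian_ge_of_complete_subgraph[OF _ H(1) T_bounds(2)] maximal H(3) by force
  hence "fact r * (real (T choose r) / real T ^ r) \<le> fact r * lagrangian G"
    by (intro mult_left_mono) auto
  thus ?thesis using falling_factorial_lower[OF T_bounds(1,2)] by simp
qed

lemma lagrangian_ge_half: "1 / 2 \<le> fact r * lagrangian G"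
proof -
  have "(real r)\<^sup>2 / real T \<le> 1 / 2" using T_bounds by (simp add: field_simps)
  thus ?thesis using lagrangian_ge by linarith
qed

lemma lagrangian_pos: "0 < lagrangian G"
proof -
  have "0 < fact r * lagrangian G" using lagrangian_ge_half by linarith
  thus ?thesis by (simp add: zero_less_mult_iff)
qed

lemma deriv_const_le: "deriv_const r \<le> real r * lagrangian G"
proof -
  have "fact r = real r * fact (r - 1)" using r_ge fact_reduce[of r] by simp
  hence "1 / 2 \<le> fact (r - 1) * (real r * lagrangian G)" using lagrangian_ge_half by (simp add: ac_simps)
  thus ?thesis unfolding deriv_const_def by (simp add: field_simps)
qed

text \<open>If only \<open>s < 1\<close> of the weight lay on \<open>V\<close>, rescaling it to
  total 1 would multiply the value by \<open>1 / s^r\<close>, contradicting maximality.\<close>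

lemma sum_w: "sum w V = 1"
proof -
  define s where "s = sum w V"
  have nn: "0 \<le> w x" if "x \<in> V" for x using pos[OF that] by simp
  have "V \<noteq> {}"
  proof
    assume "V = {}"
    hence "wval w G = 0" using edge r_ge unfolding wval_def by (intro sum.neutral) fastforce
    thus False using lagrangian_pos wval_eq by simp
  qed
  hence s0: "0 < s" unfolding s_def using finite_V pos by (intro sum_pos) auto
  have s1: "s \<le> 1" unfolding s_def
    using weighting_w finite_V V_ge by (intro finite_sum_le_has_sum[of w "{1..}" 1]) (auto simp: weighting_def)
  define w' where "w' x = (if x \<in> V then w x / s else 0)" for x
  have "weighting w'"
  proof (rule weighting_finiteI[of V])
    show "sum w' V = 1" unfolding w'_def using s0 by (simp add: s_def flip: sum_divide_distrib)
  qed (use finite_V V_ge nn s0 in \<open>auto simp: w'_def\<close>)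
  hence "wval w' G \<le> lagrangian G" using rgraph_G by (intro wval_le_lagrangian)
  moreover have "wval w' G = (\<Sum>e\<in>G. (\<Prod>x\<in>e. w x) / s ^ r)"
    unfolding wval_def
  proof (rule sum.cong[OF refl])
    fix e assume e: "e \<in> G"
    have "(\<Prod>x\<in>e. w' x) = (\<Prod>x\<in>e. w x / s)" using e by (intro prod.cong) (auto simp: w'_def)
    thus "(\<Prod>x\<in>e. w' x) = (\<Prod>x\<in>e. w x) / s ^ r" using edge[OF e] by (simp add: prod_dividef)
  qed
  ultimately have "lagrangian G / s ^ r \<le> lagrangian G"
    using wval_eq unfolding wval_def by (metis sum_divide_distrib)
  hence "1 \<le> s ^ r" using lagrangian_pos s0 by (simp add: field_simps)
  hence "s = 1" using s0 s1 r_ge power_less_one_iff[of s r] by force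
  thus ?thesis by (simp add: s_def)
qed

lemma w_nonneg: "x \<in> V \<Longrightarrow> 0 \<le> w x"
  using pos less_imp_le by blast

lemma w_outside:
  assumes "1 \<le> x" "x \<notin> V"
  shows "w x = 0"
proof -
  have "sum w (insert x V) \<le> 1"
    using weighting_w finite_V V_ge assms
    by (intro finite_sum_le_has_sum[of w "{1..}" 1]) (auto simp: weighting_def)
  hence "w x \<le> 0" using sum_w finite_V assms by simp
  thus ?thesis using weighting_w assms by (force simp: weighting_def)
qed

section \<open>First-order optimality\<close>

text \<open>The range of \<open>s\<close> keeps both weights nonnegative. \<open>H\<close> is
  arbitrary so that the bound applies to \<open>G\<close> and to modified graphs alike.\<close>

lemma transfer_le:
  assumes "u \<in> V" "v \<in> V" "u \<noteq> v" "- w v \<le> s" "s \<le> w u" "rgraph r H"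
  shows "wval (w(v := w v + s, u := w u - s)) H \<le> lagrangian H"
proof (rule wval_le_lagrangian[OF assms(6)], rule weighting_finiteI[of V])
  let ?w = "w(v := w v + s, u := w u - s)"
  have "sum f V = f u + f v + sum f (V - {u} - {v})" for f :: "nat \<Rightarrow> real"
    using finite_V assms(1-3) sum.remove[of V u f] sum.remove[of "V - {u}" v f] by simp
  moreover have "sum ?w (V - {u} - {v}) = sum w (V - {u} - {v})" by (rule sum.cong) auto
  ultimately show "sum ?w V = 1" using sum_w assms(3) by simp
qed (use assms finite_V V_ge w_nonneg w_outside in auto)

text \<open>The Lagrange multiplier condition: if the derivative at \<open>v\<close> were larger,
  moving a little weight from \<open>u\<close> to \<open>v\<close> would increase the value.\<close>

lemma wdeg_equal:
  assumes "u \<in> V" "v \<in> V"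
  shows "wdeg w G u = wdeg w G v"
proof -
  have le: "wdeg w G v \<le> wdeg w G u" if "u \<in> V" "v \<in> V" "u \<noteq> v" for u v
  proof (rule ccontr)
    assume "\<not> wdeg w G v \<le> wdeg w G u"
    hence d: "0 < wdeg w G v - wdeg w G u" (is "0 < ?d") by simp
    \<comment> \<open>With this \<open>s\<close> at most \<open>w u\<close>, the quadratic loss is
      at most half the linear gain; \<open>D >= 1\<close> permits the division.\<close>
    define D where "D = max 1 (wcodeg w G u v)"
    define s where "s = min (w u) (?d / (2 * D))"
    have D: "1 \<le> D" "wcodeg w G u v \<le> D" by (auto simp: D_def)
    have s: "0 < s" "s \<le> w u" "s \<le> ?d / (2 * D)" using pos that d D by (auto simp: s_def)
    have "wval w G + s * ?d - s\<^sup>2 * wcodeg w G u v \<le> wval w G"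
      using transfer_le[OF that, of s G] rgraph_G s w_nonneg[OF that(2)] wval_eq
        wval_transfer[OF finite_G finite_edge that(3), of w s] by simp
    hence "s * ?d \<le> s * (s * wcodeg w G u v)" by (simp add: power2_eq_square)
    hence "?d \<le> s * wcodeg w G u v" using s by simp
    also have "\<dots> \<le> s * D" using s D by simp
    also have "\<dots> \<le> ?d / (2 * D) * D" using s D by (intro mult_right_mono) auto
    also have "\<dots> = ?d / 2" using D by simp
    finally show False using d by simp
  qed
  show ?thesis using le[OF assms] le[OF assms(2,1)] by (cases "u = v") auto
qed

text \<open>The common derivative equals its own weighted average, which Euler's identity
  evaluates.\<close>

lemma wdeg_eq:
  assumes "v \<in> V"
  shows "wdeg w G v = real r * lagrangian G"
proof -
  have "real r * lagrangian G = (\<Sum>x\<in>V. w x * wdeg w G x)"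
    using sum_weight_wdeg[OF finite_G finite_V edge, of w] wval_eq by simp
  also have "\<dots> = (\<Sum>x\<in>V. w x * wdeg w G v)"
    by (intro sum.cong refl arg_cong2[where f = "(*)"] wdeg_equal assms)
  also have "\<dots> = wdeg w G v" using sum_w by (simp flip: sum_distrib_right)
  finally show ?thesis by simp
qed

lemma edge_Suc: "e \<in> G \<Longrightarrow> e \<subseteq> V \<and> card e = Suc (r - 1)"
  using edge r_ge by fastforce

section \<open>Bounds on weights, degrees and support\<close>

lemma sum_subset_le_1: "X \<subseteq> V \<Longrightarrow> sum w X \<le> 1"
  using sum_mono2[of V X w] finite_V w_nonneg sum_w by auto

text \<open>Combine \<open>1 - r^2/T <= fact r * lagrangian G\<close> with
  \<open>fact r * lagrangian G <= (1 - w v)^(r-1) <= 1 - w v\<close>, the middle step bounding the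
  derivative at \<open>v\<close>.\<close>

lemma w_le:
  assumes "v \<in> V"
  shows "w v \<le> (real r)\<^sup>2 / real T"
proof -
  have s: "sum w (V - {v}) = 1 - w v" using sum_w finite_V assms by (simp add: sum_diff1)
  have "0 \<le> sum w (V - {v})" using w_nonneg by (intro sum_nonneg) auto
  hence w01: "0 \<le> 1 - w v" "1 - w v \<le> 1" using s w_nonneg[OF assms] by auto
  have "fact r = real r * fact (r - 1)" using r_ge fact_reduce[of r] by simp
  hence "fact r * lagrangian G = fact (r - 1) * wdeg w G v" using wdeg_eq[OF assms] by simp
  also have "\<dots> \<le> fact (r - 1) * esym w (r - 1) (V - {v})"
    using wdeg_le_esym[OF finite_V w_nonneg edge_Suc assms] by (intro mult_left_mono) auto
  also have "\<dots> \<le> sum w (V - {v}) ^ (r - 1)"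
    using finite_V w_nonneg by (intro esym_le_power) auto
  also have "\<dots> \<le> (1 - w v) ^ 1" unfolding s using w01 r_ge by (intro power_decreasing) auto
  finally show ?thesis using lagrangian_ge by simp
qed

lemma degree_ge:
  assumes "v \<in> V"
  shows "degree_const r * real T ^ (r - 1) \<le> real (card {e. e \<in> G \<and> v \<in> e})"
proof -
  let ?q = "(real r)\<^sup>2 / real T"
  have q: "0 < ?q" using r_ge T_bounds by simp
  have "deriv_const r \<le> wdeg w G v" using deriv_const_le wdeg_eq[OF assms] by simp
  also have "\<dots> \<le> (\<Sum>e | e \<in> G \<and> v \<in> e. ?q ^ (r - 1))"
    unfolding wdeg_def
  proof (rule sum_mono)
    fix e assume e: "e \<in> {e. e \<in> G \<and> v \<in> e}"
    hence c: "card (e - {v}) = r - 1" using edge finite_edge by simp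
    have "(\<Prod>x\<in>e - {v}. w x) \<le> (\<Prod>x\<in>e - {v}. ?q)"
      using e w_le w_nonneg by (intro prod_mono) auto
    thus "(\<Prod>x\<in>e - {v}. w x) \<le> ?q ^ (r - 1)" using c by simp
  qed
  also have "\<dots> = real (card {e. e \<in> G \<and> v \<in> e}) * ?q ^ (r - 1)" by simp
  finally show ?thesis unfolding degree_const_def
    using r_ge T_bounds by (simp add: power_divide field_simps)
qed

lemma card_V_le: "real (card V) \<le> support_const r * real T"
proof -
  note K = consts_bounds[of r]
  have "real (card V) * (degree_const r * real T ^ (r - 1))
      \<le> (\<Sum>v\<in>V. real (card {e. e \<in> G \<and> v \<in> e}))"
    using degree_ge sum_bounded_below[of V "degree_const r * real T ^ (r - 1)"] by simp
  also have "\<dots> = real r * real (card G)"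
    using sum_over_incidences[OF finite_G finite_V edge, of "\<lambda>_. 1"] by simp
  also have "\<dots> \<le> real r * (2 ^ r * real T ^ r)"
  proof (rule mult_left_mono)
    have "(Suc T choose r) * 1 \<le> (Suc T choose r) * fact r"
      by (intro mult_left_mono) auto
    also have "\<dots> \<le> Suc T ^ r" by (rule binomial_fact_pow)
    also have "\<dots> \<le> (2 * T) ^ r" using T_bounds(2) by (intro power_mono) auto
    finally have "real (card G) \<le> real ((2 * T) ^ r)" using card_le by (simp only: of_nat_le_iff mult_1_right)
    thus "real (card G) \<le> 2 ^ r * real T ^ r" by (simp add: power_mult_distrib)
  qed simp
  also have "real T ^ r = real T * real T ^ (r - 1)" using r_ge power_Suc[of "real T" "r - 1"] by simp
  finally have "(real (card V) * degree_const r) * real T ^ (r - 1) \<le> (real r * 2 ^ r * real T) * real T ^ (r - 1)"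
    by (simp only: ac_simps)
  hence "real (card V) * degree_const r \<le> real r * 2 ^ r * real T" using T_bounds(2) by simp
  thus ?thesis unfolding support_const_def using K(3) r_ge by (simp add: field_simps)
qed

section \<open>Exchanging edges for non-edges\<close>

text \<open>Moving the weight of \<open>z\<close> onto \<open>u\<close> costs at most \<open>(w z)\<^sup>2\<close>, since the first-order terms
  cancel; afterwards the edges at \<open>z\<close> are worthless and may be traded for any set \<open>B\<close> of
  equally many non-edges.\<close>

lemma exchange_le:
  assumes "z \<in> V" "u \<in> V" "z \<noteq> u"
    and B: "B \<subseteq> {e. e \<subseteq> V - {z} \<and> card e = r} - G" "card B = card {e. e \<in> G \<and> z \<in> e}"
  shows "wval (w(u := w u + w z, z := 0)) B \<le> (w z)\<^sup>2"
proof -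
  \<comment> \<open>Written \<open>w z - w z\<close> rather than 0 to match
    \<open>wval_transfer\<close> with \<open>s = w z\<close>.\<close>
  let ?w = "w(u := w u + w z, z := w z - w z)" and ?Gz = "{e. e \<in> G \<and> z \<in> e}"
  define H where "H = (G - ?Gz) \<union> B"
  have fB: "finite B"
    by (rule finite_subset[of _ "Pow V"]) (use B finite_V in auto)
  have disj: "(G - ?Gz) \<inter> B = {}" using B by auto
  have "card H = card (G - ?Gz) + card B"
    unfolding H_def using finite_G fB disj by (intro card_Un_disjoint) auto
  also have "\<dots> = card G" using B(2) finite_G card_mono[of G ?Gz] by (simp add: card_Diff_subset)
  finally have cH: "card H = card G" .
  have rH: "rgraph r H"
    unfolding rgraph_def
  proof (intro conjI ballI)
    fix e assume "e \<in> H"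
    hence "e \<subseteq> V \<and> card e = r" using edge B(1) by (auto simp: H_def)
    thus "e \<subseteq> {1..}" "card e = r" using V_ge by (auto simp only: dest: order_trans)
  qed (use finite_G fB in \<open>auto simp: H_def\<close>)
  have "wval ?w H = wval ?w (G - ?Gz) + wval ?w B"
    unfolding wval_def H_def using finite_G fB disj by (intro sum.union_disjoint) auto
  moreover have "wval ?w (G - ?Gz) = wval ?w G"
    unfolding wval_def
  proof (rule sum.mono_neutral_left)
    show "\<forall>e\<in>G - (G - ?Gz). prod ?w e = 0" using finite_edge assms(3) by (auto intro!: prod_zero)
  qed (use finite_G in auto)
  moreover have "wval ?w G = wval w G - (w z)\<^sup>2 * wcodeg w G z u"
    using wval_transfer[OF finite_G finite_edge assms(3), of w "w z"] wdeg_equal[OF assms(1,2)] by simp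
  moreover have "wval ?w H \<le> lagrangian H"
    using assms rH w_nonneg[OF assms(1)] w_nonneg[OF assms(2)] by (intro transfer_le) auto
  moreover have "lagrangian H \<le> wval w G" using maximal[OF rH cH] wval_eq by simp
  moreover have "(w z)\<^sup>2 * wcodeg w G z u \<le> (w z)\<^sup>2 * 1"
  proof (rule mult_left_mono)
    have "wcodeg w G z u \<le> esym w (r - 2) V"
    proof (rule wcodeg_le_esym[OF finite_V w_nonneg _ assms(3)])
      show "e \<subseteq> V \<and> card e = Suc (Suc (r - 2))" if "e \<in> G" for e
        using edge[OF that] r_ge by simp
    qed
    also have "\<dots> \<le> 1" using finite_V w_nonneg sum_w by (intro esym_le_1) auto
    finally show "wcodeg w G z u \<le> 1" .
  qed simp
  ultimately have "wval ?w B \<le> (w z)\<^sup>2" by linarith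
  thus ?thesis by simp
qed

text \<open>\<open>V - {z}\<close> still has at least \<open>Suc T\<close> vertices, hence at least
  \<open>card G\<close> many \<open>r\<close>-subsets. Cancel the edges avoiding \<open>z\<close> on
  both sides.\<close>

lemma card_nonedges_ge:
  assumes "z \<in> V" "T + 2 \<le> card V"
  shows "card {e. e \<in> G \<and> z \<in> e} \<le> card ({e. e \<subseteq> V - {z} \<and> card e = r} - G)"
proof -
  let ?K = "{e. e \<subseteq> V - {z} \<and> card e = r}" and ?Gz = "{e. e \<in> G \<and> z \<in> e}"
  have fK: "finite ?K" using finite_subsets_card[of "V - {z}" r] finite_V by simp
  have "card G \<le> Suc T choose r" by (rule card_le)
  also have "\<dots> \<le> (card V - 1) choose r" using assms(2) by (intro binomial_right_mono) auto
  also have "\<dots> = card ?K" using n_subsets[of "V - {z}" r] finite_V assms(1) by simp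
  finally have "card G \<le> card ?K" .
  moreover have "card G = card ?Gz + card (G - ?Gz)"
    using finite_G card_mono[of G ?Gz] by (simp add: card_Diff_subset)
  moreover have "card ?K = card (?K - G) + card (?K \<inter> G)"
    using fK card_Diff_subset_Int[of ?K G] card_mono[of ?K "?K \<inter> G"] by simp
  moreover have "?K \<inter> G = G - ?Gz" using edge by auto
  ultimately show ?thesis by simp
qed

text \<open>With \<open>X = V - {u, v, z}\<close>, a full link of \<open>u\<close> avoiding
  \<open>z\<close> has weight \<open>esym w (r-1) X + w v * esym w (r-2) X\<close>, while the actual
  derivative at \<open>u\<close> equals that at \<open>v\<close>, at most
  \<open>esym w (r-1) X + 2 * w u\<close>. The difference must come from non-edges.\<close>

lemma nonedges_at_light_vertex:
  assumes "u \<in> V" "v \<in> V" "z \<in> V" "u \<noteq> v" "z \<noteq> v" "z \<noteq> u"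
    and light: "w z \<le> w u" "4 * w u \<le> deriv_const r"
  shows "w v * (deriv_const r / 2) - 2 * w u
    \<le> (\<Sum>e\<in>{e. e \<subseteq> V - {z} \<and> card e = r \<and> u \<in> e} - G. \<Prod>x\<in>e - {u}. w x)"
proof -
  define X where "X = V - {u, v, z}"
  have fX: "finite X" and nX: "\<And>x. x \<in> X \<Longrightarrow> 0 \<le> w x" and sX: "sum w X \<le> 1"
    using finite_V w_nonneg sum_subset_le_1[of X] by (auto simp: X_def)
  obtain k where k: "r - 1 = Suc k" using r_ge by (cases "r - 1") auto
  let ?L = "{e. e \<subseteq> V - {z} \<and> card e = r \<and> u \<in> e}" and ?p = "\<lambda>e. \<Prod>x\<in>e - {u}. w x"
  have fL: "finite ?L" by (rule finite_subset[of _ "Pow V"]) (use finite_V in auto)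
  have "insert u (V - {u, z}) = V - {z}" "Suc (r - 1) = r" using assms r_ge by auto
  hence "esym w (r - 1) (V - {u, z}) = sum ?p ?L"
    using sum_link_eq_esym[of "V - {u, z}" u w "r - 1"] finite_V by simp
  also have "\<dots> = sum ?p (?L - G) + sum ?p (?L \<inter> G)"
    using sum.Int_Diff[OF fL, of ?p G] by simp
  also have "sum ?p (?L \<inter> G) \<le> wdeg w G u"
    unfolding wdeg_def
    by (rule sum_mono2) (use finite_G w_nonneg in \<open>auto intro!: prod_nonneg\<close>)
  finally have *: "esym w (r - 1) (V - {u, z}) - wdeg w G v \<le> sum ?p (?L - G)"
    using wdeg_equal[OF assms(1,2)] by simp
  have "V - {u, z} - {v} = X" by (auto simp: X_def)
  hence e1: "esym w (r - 1) (V - {u, z}) = esym w (r - 1) X + w v * esym w k X"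
    using esym_remove[of "V - {u, z}" v w k] assms finite_V k by simp
  have "wdeg w G v \<le> esym w (r - 1) (V - {v})"
    by (rule wdeg_le_esym[OF finite_V w_nonneg edge_Suc assms(2)])
  also have "\<dots> = esym w (r - 1) (V - {v} - {u}) + w u * esym w k (V - {v} - {u})"
    using esym_remove[of "V - {v}" u w k] assms finite_V k by simp
  also have "esym w (r - 1) (V - {v} - {u}) = esym w (r - 1) X + w z * esym w k X"
  proof -
    have "V - {v} - {u} - {z} = X" by (auto simp: X_def)
    thus ?thesis using esym_remove[of "V - {v} - {u}" z w k] assms finite_V k by simp
  qed
  also have "w z * esym w k X \<le> w u * 1"
    using light w_nonneg assms esym_le_1[OF fX nX sX] esym_nonneg[OF nX] by (intro mult_mono) auto
  also have "w u * esym w k (V - {v} - {u}) \<le> w u * 1"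
    using finite_V w_nonneg assms sum_subset_le_1[of "V - {v} - {u}"]
    by (intro mult_left_mono esym_le_1) auto
  finally have e2: "wdeg w G v \<le> esym w (r - 1) X + 2 * w u" by simp
  \<comment> \<open>Passing to degree \<open>r - 2\<close> only increases the sum, and in degree
    \<open>r - 1\<close> it is at least \<open>deriv_const r - 2 * w u\<close>.\<close>
  have "esym w (r - 1) X \<le> esym w k X" unfolding k by (rule esym_Suc_le_esym[OF fX nX sX])
  hence "deriv_const r / 2 \<le> esym w k X"
    using e2 deriv_const_le wdeg_eq[OF assms(2)] light by linarith
  hence "w v * (deriv_const r / 2) \<le> w v * esym w k X"
    using w_nonneg[OF assms(2)] by (rule mult_left_mono)
  thus ?thesis using * e1 e2 by linarith
qed

section \<open>Comparing gain and loss\<close>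

text \<open>\<open>T_large\<close> is the negation of what the exchange yields when the second
  lightest vertex is not light; the other case is refuted by the choice of
  \<open>light_const\<close>.\<close>

lemma card_support_le:
  assumes T_large: "(real r) ^ 4 < degree_const r * light_const r ^ r * real T"
  shows "card V \<le> T + 1"
proof (rule ccontr)
  define a b c d where "a = degree_const r" and "b = support_const r" and "c = deriv_const r"
    and "d = light_const r"
  have K: "0 < c" "c \<le> 1 / 2" "0 < a" "a \<le> 1" "1 \<le> b" "0 < d" "d \<le> c / (8 * b)"
    using consts_bounds[of r] r_ge by (simp_all add: a_def b_def c_def d_def)
  have T: "0 < real T" "1 \<le> real T" using T_bounds(2) by auto
  assume "\<not> card V \<le> T + 1"
  hence big: "T + 2 \<le> card V" by simp
  hence ne: "V \<noteq> {}" by (intro notI) (simp only: card.empty)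
  obtain z where z: "z \<in> V" "\<And>x. x \<in> V \<Longrightarrow> w z \<le> w x"
    using arg_min_if_finite[OF finite_V ne, of w] by (metis not_less)
  have "V - {z} \<noteq> {}" using big card_Diff_singleton[OF z(1)] by (intro notI) (simp only: card.empty)
  then obtain u where u: "u \<in> V - {z}" "\<And>x. x \<in> V - {z} \<Longrightarrow> w u \<le> w x"
    using arg_min_if_finite[of "V - {z}" w] finite_V by (metis finite_Diff not_less)
  obtain v where v: "v \<in> V" "\<And>x. x \<in> V \<Longrightarrow> w x \<le> w v"
    using arg_min_if_finite[OF finite_V ne, of "\<lambda>x. - w x"] by (metis neg_less_iff_less not_less)
  let ?w' = "w(u := w u + w z, z := 0)"
  define k where "k = card {e. e \<in> G \<and> z \<in> e}"
  define N where "N = {e. e \<subseteq> V - {z} \<and> card e = r} - G"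
  have k: "a * real T ^ (r - 1) \<le> real k" unfolding k_def a_def using z by (intro degree_ge)
  have kN: "k \<le> card N" unfolding k_def N_def by (rule card_nonedges_ge[OF z(1) big])
  have fN: "finite N" unfolding N_def by (rule finite_subset[of _ "Pow V"]) (use finite_V in auto)
  have ex: "wval ?w' B \<le> (w z)\<^sup>2" if "B \<subseteq> N" "card B = k" for B
    using exchange_le[of z u B] z u that by (auto simp: N_def k_def)
  have w': "0 \<le> w x" "w x \<le> ?w' x" if "x \<in> V - {z}" for x
    using that w_nonneg z(1) by auto
  have Tr: "real T ^ r = real T ^ (r - 1) * real T" using r_ge power_Suc2[of "real T" "r - 1"] by simp
  have zu: "w z \<le> w u" using z u by auto
  show False
  proof (cases "d / real T \<le> w u")
    case True
    \<comment> \<open>All vertices of \<open>V - {z}\<close> weigh at least \<open>d/T\<close> here,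
      so any \<open>k\<close> non-edges gain at least \<open>a * d^r / T\<close>, against a loss of
      at most \<open>r^4 / T^2\<close>.\<close>
    obtain B where B: "B \<subseteq> N" "card B = k" using obtain_subset_with_card_n[OF kN] by blast
    have "a * d ^ r / real T = a * real T ^ (r - 1) * (d / real T) ^ r"
      using T by (simp add: Tr power_divide)
    also have "\<dots> \<le> real k * (d / real T) ^ r" using k K T by (intro mult_right_mono) auto
    also have "\<dots> = (\<Sum>e\<in>B. (d / real T) ^ r)" using B by simp
    also have "\<dots> \<le> wval ?w' B"
      unfolding wval_def
    proof (rule sum_mono)
      fix e assume "e \<in> B"
      hence e: "e \<subseteq> V - {z}" "card e = r" using B by (auto simp: N_def)
      have "(\<Prod>x\<in>e. d / real T) \<le> (\<Prod>x\<in>e. ?w' x)"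
      proof (rule prod_mono)
        fix x assume "x \<in> e"
        hence x: "x \<in> V - {z}" using e by auto
        have "d / real T \<le> ?w' x"
          by (rule order_trans[OF True order_trans[OF u(2)[OF x] w'(2)[OF x]]])
        thus "0 \<le> d / real T \<and> d / real T \<le> ?w' x" using K(6) T(1) by (simp only: divide_nonneg_pos less_imp_le)
      qed
      thus "(d / real T) ^ r \<le> (\<Prod>x\<in>e. ?w' x)" using e by simp
    qed
    also have "\<dots> \<le> (w z)\<^sup>2" by (rule ex[OF B])
    also have "\<dots> \<le> ((real r)\<^sup>2 / real T)\<^sup>2" using w_le w_nonneg z by (intro power_mono) auto
    also have "\<dots> = real r ^ 4 / (real T * real T)"
      by (simp add: power_divide power2_eq_square power4_eq_xxxx)
    finally have "a * d ^ r * real T \<le> real r ^ 4" using T by (simp add: field_simps)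
    thus False using T_large by (simp add: a_def d_def)
  next
    case False
    hence ud: "w u < d / real T" by simp
    \<comment> \<open>The heaviest vertex has at least the average weight
      \<open>1 / card V\<close>.\<close>
    have "1 \<le> real (card V) * w v" using sum_bounded_above[of V w "w v"] v sum_w by simp
    also have "\<dots> \<le> b * real T * w v"
      using card_V_le w_nonneg v by (intro mult_right_mono) (auto simp: b_def)
    finally have wv: "1 / (b * real T) \<le> w v" using K T by (simp add: field_simps)
    have "d / real T \<le> c / (8 * b) / real T" using K T by (intro divide_right_mono) auto
    also have "\<dots> \<le> 1 / (b * real T)" using K T by (simp add: field_simps)
    finally have uv: "u \<noteq> v" "z \<noteq> v" using ud wv zu by auto
    have "d / real T \<le> d / 1" using T K by (intro divide_left_mono) auto
    also have "\<dots> \<le> c / 8"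
    proof -
      have "c / (8 * b) \<le> c / 8" using K by (intro divide_left_mono) auto
      thus ?thesis using K(7) by linarith
    qed
    finally have lt: "4 * w u \<le> deriv_const r" using ud K(1) unfolding c_def by linarith
    let ?L = "{e. e \<subseteq> V - {z} \<and> card e = r \<and> u \<in> e} - G"
    \<comment> \<open>Since \<open>d <= c / (8 * b)\<close>, subtracting \<open>2 * w u\<close>
      costs at most half of the main term \<open>c / (2 * b * T)\<close>.\<close>
    have "c / (4 * b) / real T = 1 / (b * real T) * (c / 2) - 2 * (c / (8 * b) / real T)"
      using K T by (simp add: field_simps)
    also have "\<dots> \<le> w v * (c / 2) - 2 * w u"
    proof -
      have "1 / (b * real T) * (c / 2) \<le> w v * (c / 2)" using wv K by (intro mult_right_mono) auto
      moreover have "d / real T \<le> c / (8 * b) / real T" using K T by (intro divide_right_mono) auto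
      ultimately show ?thesis using ud by linarith
    qed
    also have "\<dots> \<le> (\<Sum>e\<in>?L. \<Prod>x\<in>e - {u}. w x)"
      unfolding c_def using nonedges_at_light_vertex[of u v z] u v z uv zu lt by auto
    finally have L1: "c / (4 * b) / real T \<le> (\<Sum>e\<in>?L. \<Prod>x\<in>e - {u}. w x)" .
    have "w u * (c / (4 * b) / real T) \<le> w u * (\<Sum>e\<in>?L. \<Prod>x\<in>e - {u}. w x)"
      using L1 w_nonneg u by (intro mult_left_mono) auto
    also have "\<dots> \<le> wval ?w' ?L"
      unfolding wval_def sum_distrib_left
    proof (rule sum_mono)
      fix e assume e: "e \<in> ?L"
      hence fe: "finite e" using finite_V finite_subset by blast
      have "w u * (\<Prod>x\<in>e - {u}. w x) = (\<Prod>x\<in>e. w x)" using e fe prod.remove[of e u w] by simp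
      also have "\<dots> \<le> (\<Prod>x\<in>e. ?w' x)" using e w' by (intro prod_mono) blast
      finally show "w u * (\<Prod>x\<in>e - {u}. w x) \<le> (\<Prod>x\<in>e. ?w' x)" .
    qed
    finally have L2: "w u * (c / (4 * b) / real T) \<le> wval ?w' ?L" .
    \<comment> \<open>\<open>M\<close> bounds both the number of non-edges at \<open>u\<close> and
      \<open>k\<close>, as \<open>exists_heavy_superset\<close> requires.\<close>
    define M where "M = card V ^ (r - 1)"
    have card_star: "card {e. e \<subseteq> V \<and> card e = r \<and> y \<in> e} \<le> M" if "y \<in> V" for y
    proof -
      have "card {e. e \<subseteq> V \<and> card e = r \<and> y \<in> e} \<le> card {f. f \<subseteq> V \<and> card f = r - 1}"
      proof (rule card_inj_on_le[of "\<lambda>e. e - {y}"])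
        show "inj_on (\<lambda>e. e - {y}) {e. e \<subseteq> V \<and> card e = r \<and> y \<in> e}"
          by (auto simp: inj_on_def)
        show "(\<lambda>e. e - {y}) ` {e. e \<subseteq> V \<and> card e = r \<and> y \<in> e} \<subseteq> {f. f \<subseteq> V \<and> card f = r - 1}"
          using finite_V finite_subset by (auto simp: card_Diff_singleton)
        show "finite {f. f \<subseteq> V \<and> card f = r - 1}" by (rule finite_subsets_card[OF finite_V])
      qed
      also have "\<dots> = card V choose (r - 1)" by (rule n_subsets[OF finite_V])
      also have "\<dots> \<le> (card V choose (r - 1)) * fact (r - 1)" by simp
      also have "\<dots> \<le> M" unfolding M_def by (rule binomial_fact_pow)
      finally show ?thesis .
    qed
    have fs: "finite {e. e \<subseteq> V \<and> card e = r \<and> y \<in> e}" for y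
      by (rule finite_subset[of _ "Pow V"]) (use finite_V in auto)
    have "card ?L \<le> card {e. e \<subseteq> V \<and> card e = r \<and> u \<in> e}" by (rule card_mono[OF fs]) auto
    hence LM: "card ?L \<le> M" using card_star[of u] u by simp
    have "k \<le> card {e. e \<subseteq> V \<and> card e = r \<and> z \<in> e}"
      unfolding k_def by (rule card_mono[OF fs]) (use edge in auto)
    hence kM: "k \<le> M" using card_star[OF z(1)] by simp
    have nn: "0 \<le> (\<Prod>x\<in>e. ?w' x)" if "e \<in> N" for e
    proof (rule prod_nonneg)
      fix x assume "x \<in> e"
      hence x: "x \<in> V - {z}" using that by (auto simp: N_def)
      show "0 \<le> ?w' x" by (rule order_trans[OF w'(1)[OF x] w'(2)[OF x]])
    qed
    have LN: "?L \<subseteq> N" by (auto simp: N_def)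
    obtain B where B: "B \<subseteq> N" "card B = k"
      and "real k * (\<Sum>e\<in>?L. \<Prod>x\<in>e. ?w' x) \<le> real M * (\<Sum>e\<in>B. \<Prod>x\<in>e. ?w' x)"
      by (rule exists_heavy_superset[OF fN LN kN nn LM kM])
    hence heavy: "real k * wval ?w' ?L \<le> real M * wval ?w' B" by (simp only: wval_def)
    have M: "0 < real M" "real M \<le> b ^ (r - 1) * real T ^ (r - 1)"
    proof -
      show "0 < real M" unfolding M_def using big by simp
      have "real (card V) ^ (r - 1) \<le> (b * real T) ^ (r - 1)"
        using card_V_le by (intro power_mono) (auto simp: b_def)
      thus "real M \<le> b ^ (r - 1) * real T ^ (r - 1)" by (simp add: M_def power_mult_distrib)
    qed
    have pos_gain: "0 \<le> w u * (c / (4 * b) / real T)" using K T w_nonneg u by auto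
    have "a * real T ^ (r - 1) * (w u * (c / (4 * b) / real T)) \<le> real k * wval ?w' ?L"
      using k L2 pos_gain by (intro mult_mono) auto
    also have "\<dots> \<le> real M * (w z)\<^sup>2"
      by (rule order_trans[OF heavy mult_left_mono[OF ex[OF B]]]) simp
    \<comment> \<open>Only one factor \<open>w z\<close> is bounded by \<open>d/T\<close>; the other
      becomes \<open>w u\<close>, which cancels against the gain however small \<open>w u\<close>
      is.\<close>
    also have "\<dots> \<le> (b ^ (r - 1) * real T ^ (r - 1)) * (w u * (d / real T))"
    proof (rule mult_mono)
      have "w z * w z \<le> w u * (d / real T)"
        using zu ud w_nonneg[OF z(1)] by (intro mult_mono) linarith+
      thus "(w z)\<^sup>2 \<le> w u * (d / real T)" by (simp add: power2_eq_square)
    qed (use M K T in auto)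
    finally have "(real T ^ (r - 1) * w u / real T) * (a * (c / (4 * b)))
        \<le> (real T ^ (r - 1) * w u / real T) * (b ^ (r - 1) * d)"
      by (simp add: ac_simps)
    hence "a * (c / (4 * b)) \<le> b ^ (r - 1) * d"
      using T pos u by (subst (asm) mult_le_cancel_left_pos) auto
    \<comment> \<open>The 8 in \<open>light_const\<close> against the 4 in the gain supplies the
      contradictory factor 2.\<close>
    also have "b ^ (r - 1) * d = a * (c / (8 * b))"
      using K by (simp add: a_def b_def c_def d_def light_const_def)
    finally show False using K by (simp add: field_simps)
  qed
qed

end

section \<open>From the size of the support to the initial segment\<close>

theorem theorem4p1:
  fixes r :: nat
  assumes "r \<ge> 3"
  shows "\<exists>t0::nat. \<forall>t\<ge>t0. \<forall>(G::nat set set) (w::nat \<Rightarrow> real).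
    rgraph r G \<and>
    (t - 1) choose r \<le> card G \<and> card G \<le> t choose r \<and>
    (\<forall>H. rgraph r H \<and> card H = card G \<longrightarrow> lagrangian H \<le> lagrangian G) \<and>
    maximal_weighting G w \<and> decreasing_weighting w \<and>
    (\<forall>x\<in>\<Union>G. w x > 0)
    \<longrightarrow> G \<subseteq> {e. e \<subseteq> {1..t} \<and> card e = r}"
proof -
  let ?C = "degree_const r * light_const r ^ r"
  have C: "0 < ?C" using consts_bounds[of r] assms by simp
  obtain n where n: "real r ^ 4 / ?C < real n" using reals_Archimedean2 by blast
  show ?thesis
  \<comment> \<open>The summands \<open>2 * r^2\<close> and \<open>n\<close> secure
    \<open>T_ge\<close> and \<open>T_large\<close> for \<open>T = t - 1\<close>; the 1 accounts for
    that shift.\<close>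
  proof (intro exI[of _ "2 * r\<^sup>2 + n + 1"] allI impI, elim conjE)
    fix t G w
    assume t: "2 * r\<^sup>2 + n + 1 \<le> t" and G: "rgraph r G" "t - 1 choose r \<le> card G" "card G \<le> t choose r"
      "\<forall>H. rgraph r H \<and> card H = card G \<longrightarrow> lagrangian H \<le> lagrangian G"
      "maximal_weighting G w" and dec: "decreasing_weighting w" and pos: "\<forall>x\<in>\<Union>G. w x > 0"
    interpret lagrangian_maximiser r "t - 1" G w
      by unfold_locales (use assms t G pos in auto)
    have "real n \<le> real (t - 1)" using t by simp
    hence "real r ^ 4 / ?C < real (t - 1)" using n by linarith
    hence "real r ^ 4 < ?C * real (t - 1)" using C by (simp add: field_simps)
    hence cV: "card V \<le> t" using card_support_le t by simp
    \<comment> \<open>As \<open>w\<close> decreases, every positive integer below a vertex of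
      \<open>V\<close> has positive weight and so lies in \<open>V\<close>: thus \<open>V\<close> is
      an initial segment.\<close>
    have "x \<le> t" if "x \<in> V" for x
    proof -
      have "{1..x} \<subseteq> V"
      proof
        fix y assume y: "y \<in> {1..x}"
        have "w x \<le> w y" using dec y by (cases "y = x") (auto simp: decreasing_weighting_def)
        hence "w y \<noteq> 0" using pos that by force
        thus "y \<in> V" using w_outside y by auto
      qed
      hence "card {1..x} \<le> card V" using finite_V by (rule card_mono[rotated])
      thus ?thesis using cV by simp
    qed
    thus "G \<subseteq> {e. e \<subseteq> {1..t} \<and> card e = r}" using edge V_ge by fastforce
  qed
qed

end
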